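(* Let $A\in\mathbb{R}^{M\times N}$, let $X\in\mathbb{R}^{N\times K}$ have rank $r\ge 1$ and exactly $s$ nonzero rows, and let $Y=AX$. Assume $s<\operatorname{spark}(A)$ and that $A$ satisfies the $(r,s)$-spherical section property, or, equivalently, that $r\le s<\min\{\iota_r(A)^2/r,\ \operatorname{spark}(A)\}$. Then every (globally) minimizing sequence of the problem $$\min_{Z\in\mathbb{R}^{N\times K}}\mathit{ow}\ell_{2,1}(Z)\quad\text{subject to }AZ=Y$$ is bounded, and the set of optimal solutions of this problem is nonempty.
   Context: $\operatorname{spark}(A)$ is the smallest number of linearly dependent columns of $A$ (convention: $+\infty$ if the columns are linearly independent). For $Z\in\mathbb{R}^{N\times K}$ with rows $z_n$ (as $1\times K$ vectors), $\mathit{ow}\ell_{2,1}(Z)=\sum_{n=1}^N\sqrt{z_n(Z^TZ)^\dagger z_n^T}$, with $(\cdot)^\dagger$ the Moore–Penrose pseudo-inverse. The rank-$r$ singularity set is $\Omega_r(A)=\{Z\in\mathbb{R}^{N\times K}:\operatorname{rank}(Z)\ge r,\ \operatorname{rank}(AZ)<\operatorname{rank}(Z)\}$, and $\iota_r(A)=\inf_{Z\in\Omega_r(A)}\mathit{ow}\ell_{2,1}(Z)$ (with $\inf\emptyset=+\infty$). $A$ satisfies the $(r,s)$-spherical section property if $\mathit{ow}\ell_{2,1}(Z)>\sqrt{rs}$ for all $Z\in\Omega_r(A)$. A minimizing sequence is a sequence of feasible $Z_k$ with $\mathit{ow}\ell_{2,1}(Z_k)$ converging to the infimum of the problem. *)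

theory Defs
  imports "HOL-Analysis.Analysis"
begin

text \<open>Over the reals the conjugate transpose in the Penrose conditions is the transpose;
  the four conditions determine the pseudo-inverse uniquely, and every real matrix has one.\<close>

definition is_pseudo_inverse :: "real^'n^'m \<Rightarrow> real^'m^'n \<Rightarrow> bool" where
  "is_pseudo_inverse B P \<longleftrightarrow>
     B ** P ** B = B \<and> P ** B ** P = P \<and>
     transpose (B ** P) = B ** P \<and> transpose (P ** B) = P ** B"

definition pseudo_inverse :: "real^'n^'m \<Rightarrow> real^'m^'n" where
  "pseudo_inverse B = (THE P. is_pseudo_inverse B P)"

definition owl21 :: "real^'k^'n \<Rightarrow> real" where
  "owl21 Z = (\<Sum>n\<in>UNIV. sqrt (row n Z \<bullet> (pseudo_inverse (transpose Z ** Z) *v row n Z)))"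

text \<open>Linear dependence is that of the indexed family of columns, not of the set \<^term>\<open>columns A\<close>:
  two equal columns are dependent. If no subfamily is dependent, the infimum in
  \<^typ>\<open>enat\<close> is \<open>\<infinity>\<close>.\<close>

definition spark :: "real^'n^'m \<Rightarrow> enat" where
  "spark A = Inf {enat (card I) | I.
     \<exists>c. (\<exists>i\<in>I. c i \<noteq> 0) \<and> (\<Sum>i\<in>I. c i *\<^sub>R column i A) = 0}"

definition num_nonzero_rows :: "real^'k^'n \<Rightarrow> nat" where
  "num_nonzero_rows X = card {n. row n X \<noteq> 0}"

definition singularity_set :: "nat \<Rightarrow> real^'n^'m \<Rightarrow> (real^'k^'n) set" where
  "singularity_set r A = {Z. r \<le> rank Z \<and> rank (A ** Z) < rank Z}"

text \<open>The number \<open>K\<close> of columns of the matrices \<open>Z\<close> is not determined by \<open>r\<close> and \<open>A\<close>;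
  it is passed as a type argument.\<close>

definition iota :: "'k::finite itself \<Rightarrow> nat \<Rightarrow> real^'n^'m \<Rightarrow> ereal" where
  "iota _ r A = (INF Z\<in>(singularity_set r A :: (real^'k^'n) set). ereal (owl21 Z))"

definition spherical_section :: "'k::finite itself \<Rightarrow> nat \<Rightarrow> nat \<Rightarrow> real^'n^'m \<Rightarrow> bool" where
  "spherical_section _ r s A \<longleftrightarrow>
     (\<forall>Z\<in>(singularity_set r A :: (real^'k^'n) set). owl21 Z > sqrt (real r * real s))"

definition feasible :: "real^'n^'m \<Rightarrow> real^'k^'m \<Rightarrow> (real^'k^'n) set" where
  "feasible A Y = {Z. A ** Z = Y}"

definition optimal_value :: "real^'n^'m \<Rightarrow> real^'k^'m \<Rightarrow> ereal" where
  "optimal_value A Y = (INF Z\<in>feasible A Y. ereal (owl21 Z))"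

definition minimizing_sequence ::
    "real^'n^'m \<Rightarrow> real^'k^'m \<Rightarrow> (nat \<Rightarrow> real^'k^'n) \<Rightarrow> bool" where
  "minimizing_sequence A Y Z \<longleftrightarrow>
     (\<forall>j. Z j \<in> feasible A Y) \<and> (\<lambda>j. ereal (owl21 (Z j))) \<longlonglongrightarrow> optimal_value A Y"

definition optimal_solutions :: "real^'n^'m \<Rightarrow> real^'k^'m \<Rightarrow> (real^'k^'n) set" where
  "optimal_solutions A Y = {Z \<in> feasible A Y. \<forall>W\<in>feasible A Y. owl21 Z \<le> owl21 W}"

end

theory Submission
  imports Defs
begin

text \<open>The summands of \<^term>\<open>owl21 Z\<close> are the square roots of the diagonal entries of the orthogonal
  projector \<open>P\<close> onto the column space of \<open>Z\<close>, so \<^term>\<open>owl21 Z\<close> depends only on that space and grows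
  with it. Orthogonal projectors form a compact set on which the rank is the continuous function trace.
  If feasible matrices \<open>Z\<^sub>j\<close> whose values tend to at most \<open>sqrt (r s)\<close> were unbounded, a limit of
  their projectors and of \<open>Z\<^sub>j / norm Z\<^sub>j\<close> would be a singularity of rank at least \<open>r\<close> violating
  the spherical section property; since \<open>X\<close> itself has value at most \<open>sqrt (r s)\<close> by
  Cauchy-Schwarz, boundedness and then existence follow by compactness.\<close>

section \<open>Orthogonal projectors: range, trace and diagonal entries\<close>

definition orthogonal_projector :: "real^'n^'n \<Rightarrow> bool" where
  "orthogonal_projector P \<longleftrightarrow> transpose P = P \<and> P ** P = P"

lemma inner_matrix_vector_mult_left:
  fixes A :: "real^'n^'m"
  shows "(A *v x) \<bullet> y = x \<bullet> (transpose A *v y)"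
  by (metis dot_lmul_matrix vector_transpose_matrix)

lemma orthogonal_projector_fixes_range:
  assumes "orthogonal_projector P"
  shows "x \<in> range ((*v) P) \<longleftrightarrow> P *v x = x"
  using assms unfolding orthogonal_projector_def
  by (auto simp: matrix_vector_mul_assoc intro: range_eqI[OF sym])

lemma orthogonal_projector_mult_left:
  assumes "orthogonal_projector P" "range ((*v) Q) \<subseteq> range ((*v) P)"
  shows "P ** Q = Q"
  using assms orthogonal_projector_fixes_range[OF assms(1)]
  by (auto simp: matrix_eq matrix_vector_mul_assoc[symmetric] image_subset_iff)

text \<open>Each projector fixes the range of the other, so \<open>P ** Q = Q\<close> and
  \<open>Q ** P = P\<close>; transposing the first equation gives \<open>Q ** P = Q\<close>.\<close>

lemma orthogonal_projector_unique:
  assumes P: "orthogonal_projector P" and Q: "orthogonal_projector Q"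
    and "range ((*v) P) = range ((*v) Q)"
  shows "P = Q"
proof -
  have "P ** Q = Q" "Q ** P = P"
    using assms orthogonal_projector_mult_left by blast+
  then show ?thesis
    using P Q unfolding orthogonal_projector_def by (metis matrix_transpose_mul)
qed

text \<open>The witness is the sum of b b^T over an orthonormal basis of \<open>S\<close>; its trace
  adds up the squared norms of the basis vectors.\<close>

lemma orthogonal_projector_on_subspace:
  fixes S :: "(real^'n) set"
  assumes "subspace S"
  obtains P where "orthogonal_projector P" "range ((*v) P) = S" "trace P = dim S"
proof -
  obtain B where B: "B \<subseteq> S" "pairwise orthogonal B" "\<And>x. x \<in> B \<Longrightarrow> norm x = 1"
    "independent B" "card B = dim S" "span B = S"
    using orthonormal_basis_subspace[OF assms] by metis
  have fin: "finite B" using B(4) independent_imp_finite by blast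
  define P :: "real^'n^'n" where "P = (\<chi> i j. \<Sum>b\<in>B. b$i * b$j)"
  have Pv: "P *v x = (\<Sum>b\<in>B. (b \<bullet> x) *\<^sub>R b)" for x
    by (simp add: vec_eq_iff P_def matrix_vector_mult_def inner_vec_def sum_distrib_right
        sum_distrib_left sum.swap[of _ B] mult_ac)
  have delta: "b \<bullet> c = (if b = c then 1 else 0)" if "b \<in> B" "c \<in> B" for b c
    using that B(2,3) by (auto simp: pairwise_def orthogonal_def dot_square_norm)
  have "P *v c = c" if "c \<in> B" for c
  proof -
    have "P *v c = (\<Sum>b\<in>B. if b = c then b else 0)"
      unfolding Pv using that by (intro sum.cong) (auto simp: delta)
    then show ?thesis using that fin by simp
  qed
  then have fix_S: "P *v x = x" if "x \<in> S" for x
    using that linear_eq_on_span[of "(*v) P" id B x] B(6)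
    by (simp add: linear_id)
  have in_S: "P *v x \<in> S" for x
    unfolding Pv using B(1) by (intro subspace_sum assms subspace_scale) auto
  show thesis
  proof
    have "transpose P = P" by (simp add: P_def transpose_def mult.commute)
    moreover have "P ** P = P"
      using fix_S in_S by (simp add: matrix_eq matrix_vector_mul_assoc[symmetric])
    ultimately show "orthogonal_projector P"
      unfolding orthogonal_projector_def by blast
    show "range ((*v) P) = S"
      using fix_S in_S by (metis image_subset_iff rangeI subsetI subset_antisym)
    have "trace P = (\<Sum>b\<in>B. b \<bullet> b)"
      by (simp add: trace_def P_def inner_vec_def sum.swap[of _ B])
    also have "\<dots> = card B" using B(3) by (simp add: dot_square_norm)
    finally show "trace P = dim S" using B(5) by simp
  qed
qed

lemma subspace_range_matrix: "subspace (range ((*v) A))"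
  for A :: "real^'n^'m"
  using linear_subspace_image[OF matrix_vector_mul_linear subspace_UNIV, of A] .

text \<open>By uniqueness, \<open>P\<close> is the projector built from an orthonormal basis of its
  range, whose trace is the dimension.\<close>

lemma trace_orthogonal_projector:
  assumes "orthogonal_projector P"
  shows "trace P = rank P"
proof -
  obtain Q where "orthogonal_projector Q" "range ((*v) Q) = range ((*v) P)"
    "trace Q = dim (range ((*v) P))"
    using orthogonal_projector_on_subspace[OF subspace_range_matrix] by blast
  then show ?thesis
    using orthogonal_projector_unique[OF assms, of Q] by (simp add: rank_dim_range)
qed

lemma orthogonal_projector_diagonal:
  assumes "orthogonal_projector P"
  shows "P $ i $ i = (\<Sum>j\<in>UNIV. (P $ i $ j)\<^sup>2)"
proof -
  have "transpose P = P" "P ** P = P"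
    using assms unfolding orthogonal_projector_def by auto
  then have "P $ i $ i = (P ** transpose P) $ i $ i" by simp
  also have "\<dots> = (\<Sum>j\<in>UNIV. (P $ i $ j)\<^sup>2)"
    by (simp add: matrix_matrix_mult_def transpose_def power2_eq_square)
  finally show ?thesis .
qed

lemma orthogonal_projector_diagonal_nonneg:
  "orthogonal_projector P \<Longrightarrow> 0 \<le> P $ i $ i"
  by (simp add: orthogonal_projector_diagonal sum_nonneg)

text \<open>A diagonal entry is the sum of squares of its row. It therefore dominates its own
  square, which forces it to be at most 1, and with it every square in the row.\<close>

lemma orthogonal_projector_entry_le_1:
  assumes "orthogonal_projector P"
  shows "\<bar>P $ i $ j\<bar> \<le> 1"
proof -
  have le: "(P $ i $ j)\<^sup>2 \<le> P $ i $ i" for j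
    unfolding orthogonal_projector_diagonal[OF assms, of i]
    by (rule member_le_sum) auto
  have "P $ i $ i \<le> 1"
    using le[of i] by (auto simp: power2_eq_square mult_le_cancel_left2 intro: ccontr)
  then have "(P $ i $ j)\<^sup>2 \<le> 1" using le order_trans by blast
  then show ?thesis by (simp add: abs_square_le_1)
qed

lemma matrix_diff_ldistrib: "A ** (B - C) = A ** B - A ** C"
  and matrix_diff_rdistrib: "(B - C) ** D = B ** D - C ** D"
  and transpose_diff: "transpose (B - C) = transpose B - transpose C"
  for A :: "real^'n^'m" and B C :: "real^'k^'n" and D :: "real^'l^'k"
  by (simp_all add: matrix_matrix_mult_def transpose_def vec_eq_iff algebra_simps sum_subtractf)

text \<open>The difference \<open>P - Q\<close> is again an orthogonal projector, so its diagonal is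
  nonnegative. This is why \<open>owl21\<close> grows with the column space.\<close>

lemma orthogonal_projector_diagonal_mono:
  assumes P: "orthogonal_projector P" and Q: "orthogonal_projector Q" and "P ** Q = Q"
  shows "Q $ i $ i \<le> P $ i $ i"
proof -
  have "Q ** P = Q"
    using assms unfolding orthogonal_projector_def by (metis matrix_transpose_mul)
  then have "orthogonal_projector (P - Q)"
    using assms unfolding orthogonal_projector_def
    by (simp add: matrix_diff_ldistrib matrix_diff_rdistrib transpose_diff)
  from orthogonal_projector_diagonal_nonneg[OF this, of i] show ?thesis by simp
qed

section \<open>Uniqueness of the pseudo-inverse, and existence for symmetric matrices\<close>

text \<open>The symmetry conditions allow the factors to be swapped under a transpose, giving
  \<open>B ** P = B ** Q\<close> and \<open>P ** B = Q ** B\<close>; then P = PBP = QBQ = Q.\<close>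

lemma is_pseudo_inverse_unique:
  assumes P: "is_pseudo_inverse B P" and Q: "is_pseudo_inverse B Q"
  shows "P = Q"
proof -
  have BP: "B ** P ** B = B" "P ** B ** P = P" "transpose (B ** P) = B ** P"
    "transpose (P ** B) = P ** B"
    and BQ: "B ** Q ** B = B" "Q ** B ** Q = Q" "transpose (B ** Q) = B ** Q"
    "transpose (Q ** B) = Q ** B"
    using P Q unfolding is_pseudo_inverse_def by auto
  have "B ** P = (B ** Q) ** (B ** P)" by (metis BQ(1) matrix_mul_assoc)
  also have "\<dots> = transpose ((B ** P) ** (B ** Q))"
    using BP BQ by (simp add: matrix_transpose_mul)
  also have "\<dots> = B ** Q" by (metis BP(1) BQ(3) matrix_mul_assoc)
  finally have 1: "B ** P = B ** Q" .
  have "P ** B = (P ** B) ** (Q ** B)" by (metis BQ(1) matrix_mul_assoc)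
  also have "\<dots> = transpose ((Q ** B) ** (P ** B))"
    using BP BQ by (simp add: matrix_transpose_mul)
  also have "\<dots> = Q ** B" by (metis BP(1) BQ(4) matrix_mul_assoc)
  finally have 2: "P ** B = Q ** B" .
  show ?thesis by (metis 1 2 BP(2) BQ(2) matrix_mul_assoc)
qed

text \<open>A symmetric \<open>B\<close> maps its range bijectively to itself. The pseudo-inverse
  inverts it there and vanishes on the orthogonal complement. The Gram matrices inside
  \<open>owl21\<close> are of this kind.\<close>

lemma ex_pseudo_inverse_symmetric:
  fixes B :: "real^'n^'n"
  assumes sym: "transpose B = B"
  shows "\<exists>P. is_pseudo_inverse B P"
proof -
  obtain Q where Q: "orthogonal_projector Q" "range ((*v) Q) = range ((*v) B)"
    using orthogonal_projector_on_subspace[OF subspace_range_matrix] by blast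
  have QB: "Q ** B = B" using Q orthogonal_projector_mult_left by blast
  have Qs: "transpose Q = Q" "Q ** Q = Q" using Q(1) unfolding orthogonal_projector_def by auto
  have BQ: "B ** Q = B" by (metis QB Qs(1) matrix_transpose_mul sym)
  \<comment> \<open>\<open>C\<close> agrees with \<open>B\<close> on the range of \<open>B\<close> and with the identity on its orthogonal
    complement, the kernel of \<open>B\<close>.\<close>
  define C where "C = B - (Q - mat 1)"
  have CQ: "C ** Q = B" and QC: "Q ** C = B"
    using QB BQ Qs unfolding C_def
    by (simp_all add: matrix_diff_ldistrib matrix_diff_rdistrib)
  \<comment> \<open>Injectivity of \<open>C\<close>: a kernel vector is killed by B = QC, hence
    fixed by \<open>Q\<close>, hence of the form By, and is then orthogonal to itself.\<close>
  have "x = 0" if "C *v x = 0" for x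
  proof -
    have "B *v x = 0" using that QC by (metis matrix_vector_mul_assoc matrix_vector_mult_0_right)
    moreover from this have "Q *v x = x"
      using that by (simp add: C_def matrix_vector_mult_diff_rdistrib)
    moreover from this obtain y where "x = B *v y" using Q(2) by (metis imageE rangeI)
    ultimately have "x \<bullet> x = 0" using inner_matrix_vector_mult_left[of B y x] sym by simp
    then show ?thesis by simp
  qed
  then obtain D where DC: "D ** C = mat 1" using matrix_left_invertible_ker by blast
  then have CD: "C ** D = mat 1" using matrix_left_right_inverse by blast
  have DQ: "D ** Q = Q ** D"
    by (metis CD CQ DC QC matrix_mul_assoc matrix_mul_lid matrix_mul_rid)
  have "B ** (Q ** D) = Q" by (metis BQ CD QC matrix_mul_assoc matrix_mul_rid)
  moreover have "(Q ** D) ** B = Q" by (metis DQ DC QC QB CQ matrix_mul_assoc matrix_mul_lid)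
  ultimately have "is_pseudo_inverse B (Q ** D)"
    unfolding is_pseudo_inverse_def using QB Qs by (simp add: matrix_mul_assoc)
  then show ?thesis ..
qed

lemma is_pseudo_inverse_pseudo_inverse:
  "\<exists>P. is_pseudo_inverse B P \<Longrightarrow> is_pseudo_inverse B (pseudo_inverse B)"
  unfolding pseudo_inverse_def by (rule theI') (blast intro: is_pseudo_inverse_unique)

section \<open>The projector onto the column space, and bounds on \<open>owl21\<close>\<close>

text \<open>The diagonal entries of this matrix are the radicands in \<open>owl21\<close>.\<close>

definition column_projector :: "real^'k^'n \<Rightarrow> real^'n^'n" where
  "column_projector Z = Z ** pseudo_inverse (transpose Z ** Z) ** transpose Z"

lemma transpose_mult_self_eq_0:
  fixes M :: "real^'n^'m"
  assumes "transpose M ** M = 0"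
  shows "M = 0"
proof -
  have "(M *v x) \<bullet> (M *v x) = 0" for x
    using assms by (simp add: inner_matrix_vector_mult_left matrix_vector_mul_assoc)
  then show ?thesis by (simp add: matrix_eq)
qed

lemma column_projector_mult: "column_projector Z ** Z = Z"
  and orthogonal_projector_column_projector: "orthogonal_projector (column_projector Z)"
proof -
  define B where "B = transpose Z ** Z"
  define P where "P = pseudo_inverse B"
  have symB: "transpose B = B" by (simp add: B_def matrix_transpose_mul)
  then have P: "is_pseudo_inverse B P"
    unfolding P_def by (intro is_pseudo_inverse_pseudo_inverse ex_pseudo_inverse_symmetric)
  \<comment> \<open>The Penrose conditions are invariant under transposing both matrices, so
    uniqueness makes \<open>P\<close> symmetric.\<close>
  then have "is_pseudo_inverse B (transpose P)"
    using symB unfolding is_pseudo_inverse_def by (metis matrix_mul_assoc matrix_transpose_mul)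
  then have symP: "transpose P = P" using P is_pseudo_inverse_unique by blast
  have def': "column_projector Z = Z ** P ** transpose Z"
    by (simp add: column_projector_def P_def B_def)
  have BPB: "B ** (P ** B) = B" using P by (simp add: is_pseudo_inverse_def matrix_mul_assoc)
  \<comment> \<open>The defect \<open>M\<close> has its columns in the column space of
    \<open>Z\<close> and is also orthogonal to that space, hence vanishes.\<close>
  define M where "M = Z ** (P ** B) - Z"
  have "transpose Z ** M = 0"
    using BPB unfolding M_def by (simp add: matrix_diff_ldistrib matrix_mul_assoc B_def)
  moreover have "M = Z ** (P ** B - mat 1)"
    unfolding M_def by (simp add: matrix_diff_ldistrib)
  then have "transpose M ** M = transpose (P ** B - mat 1) ** (transpose Z ** M)"
    by (metis matrix_mul_assoc matrix_transpose_mul)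
  ultimately have "transpose M ** M = 0" by simp
  then have "M = 0" by (rule transpose_mult_self_eq_0)
  then show *: "column_projector Z ** Z = Z"
    unfolding M_def def' B_def by (simp add: matrix_mul_assoc)
  have "column_projector Z ** column_projector Z = column_projector Z"
    by (metis * def' matrix_mul_assoc)
  then show "orthogonal_projector (column_projector Z)"
    unfolding orthogonal_projector_def by (simp add: def' matrix_transpose_mul symP matrix_mul_assoc)
qed

lemma range_column_projector: "range ((*v) (column_projector Z)) = range ((*v) Z)"
proof
  show "range ((*v) (column_projector Z)) \<subseteq> range ((*v) Z)"
    unfolding column_projector_def by (auto simp: matrix_vector_mul_assoc[symmetric])
  show "range ((*v) Z) \<subseteq> range ((*v) (column_projector Z))"
    using column_projector_mult[of Z] by (metis image_subset_iff matrix_vector_mul_assoc rangeI)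
qed

lemma rank_column_projector: "rank (column_projector Z) = rank Z"
  by (simp add: rank_dim_range range_column_projector)

lemma owl21_eq: "owl21 Z = (\<Sum>i\<in>UNIV. sqrt (column_projector Z $ i $ i))"
proof -
  have "row i Z \<bullet> (M *v row i Z) = (Z ** (M ** transpose Z)) $ i $ i" for i M
    by (simp add: matrix_matrix_mult_def matrix_vector_mult_def row_def transpose_def inner_vec_def)
  then show ?thesis
    by (simp add: owl21_def column_projector_def matrix_mul_assoc)
qed

lemma owl21_nonneg: "0 \<le> owl21 Z"
  unfolding owl21_eq
  by (intro sum_nonneg) (simp add: orthogonal_projector_diagonal_nonneg orthogonal_projector_column_projector)

lemma owl21_le_sum_sqrt_diagonal:
  assumes "orthogonal_projector P" "P ** Z = Z"
  shows "owl21 Z \<le> (\<Sum>i\<in>UNIV. sqrt (P $ i $ i))"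
proof -
  have "P ** column_projector Z = column_projector Z"
    using assms(2) by (simp add: column_projector_def matrix_mul_assoc)
  then show ?thesis
    unfolding owl21_eq
    using orthogonal_projector_diagonal_mono[OF assms(1) orthogonal_projector_column_projector]
    by (intro sum_mono) simp
qed

lemma trace_column_projector: "trace (column_projector Z) = rank Z"
  by (simp add: trace_orthogonal_projector orthogonal_projector_column_projector rank_column_projector)

lemma column_projector_diagonal_zero_row:
  "row i Z = 0 \<Longrightarrow> column_projector Z $ i $ i = 0"
  by (simp add: column_projector_def matrix_mul_assoc[symmetric] matrix_matrix_mult_def
      row_def vec_eq_iff)

text \<open>The trace equals the rank, and zero rows of \<open>Z\<close> contribute nothing to
  it.\<close>

lemma sum_diagonal_column_projector:
  "(\<Sum>i | row i Z \<noteq> 0. column_projector Z $ i $ i) = rank Z"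
  unfolding trace_column_projector[symmetric] trace_def
  by (rule sum.mono_neutral_left) (auto simp: column_projector_diagonal_zero_row)

lemma rank_le_num_nonzero_rows: "rank Z \<le> num_nonzero_rows Z"
proof -
  have "column_projector Z $ i $ i \<le> 1" for i
    using orthogonal_projector_entry_le_1[OF orthogonal_projector_column_projector, of Z i i] by simp
  then have "real (rank Z) \<le> (\<Sum>i | row i Z \<noteq> 0. 1)"
    unfolding sum_diagonal_column_projector[symmetric] by (intro sum_mono)
  then show ?thesis by (simp add: num_nonzero_rows_def)
qed

text \<open>Cauchy-Schwarz over the nonzero rows: the squared summands add up to the rank.\<close>

lemma owl21_le_sqrt_rank_rows:
  "owl21 Z \<le> sqrt (real (rank Z) * real (num_nonzero_rows Z))"
proof -
  let ?P = "column_projector Z"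
  have nonneg: "0 \<le> ?P $ i $ i" for i
    by (simp add: orthogonal_projector_diagonal_nonneg orthogonal_projector_column_projector)
  have "owl21 Z = (\<Sum>i | row i Z \<noteq> 0. sqrt (?P $ i $ i))"
    unfolding owl21_eq
    by (rule sum.mono_neutral_right) (auto simp: column_projector_diagonal_zero_row)
  then have "(owl21 Z)\<^sup>2 \<le> (\<Sum>i | row i Z \<noteq> 0. (sqrt (?P $ i $ i))\<^sup>2) * num_nonzero_rows Z"
    by (simp add: sum_squared_le_sum_of_squares num_nonzero_rows_def)
  also have "\<dots> = real (rank Z) * real (num_nonzero_rows Z)"
    by (simp add: nonneg sum_diagonal_column_projector)
  finally show ?thesis by (rule real_le_rsqrt)
qed

text \<open>The vectors of a basis of the range of \<open>P\<close> become distinct columns of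
  \<open>Z\<close>, and the other columns are zero. The bound by \<open>CARD('k)\<close> provides
  enough columns.\<close>

lemma ex_column_projector_eq:
  fixes P :: "real^'n^'n"
  assumes P: "orthogonal_projector P" and "rank P \<le> CARD('k::finite)"
  obtains Z :: "real^'k^'n" where "column_projector Z = P"
proof -
  obtain B where B: "B \<subseteq> range ((*v) P)" "independent B" "card B = dim (range ((*v) P))"
    and spanB: "span B = range ((*v) P)"
    using orthonormal_basis_subspace[OF subspace_range_matrix, of P] by metis
  have fin: "finite B" using B(2) independent_imp_finite by blast
  have "card B \<le> card (UNIV :: 'k set)" using B(3) assms(2) by (simp add: rank_dim_range)
  then obtain f :: "real^'n \<Rightarrow> 'k" where f: "inj_on f B"
    using card_le_inj[OF fin, of "UNIV :: 'k set"] by auto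
  define Z :: "real^'k^'n" where
    "Z = (\<chi> i k. if k \<in> f ` B then inv_into B f k $ i else 0)"
  have col: "column k Z = (if k \<in> f ` B then inv_into B f k else 0)" for k
    by (simp add: Z_def column_def vec_eq_iff)
  have "column k Z \<in> span B" for k
    by (simp add: col inv_into_into span_base span_zero)
  then have "Z *v x \<in> span B" for x
    unfolding matrix_mult_sum scalar_mult_eq_scaleR by (intro span_sum span_scale)
  then have "range ((*v) Z) \<subseteq> span B" by blast
  moreover have "b \<in> range ((*v) Z)" if "b \<in> B" for b
  proof -
    have "Z *v axis (f b) 1 = b"
      using that f by (simp add: matrix_vector_mult_basis col)
    then show ?thesis by (metis rangeI)
  qed
  then have "span B \<subseteq> range ((*v) Z)" by (intro span_minimal subspace_range_matrix) blast
  ultimately have "range ((*v) (column_projector Z)) = range ((*v) P)"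
    using spanB range_column_projector by blast
  then show thesis
    using that orthogonal_projector_unique[OF orthogonal_projector_column_projector P] by blast
qed

text \<open>If \<open>A\<close> is injective on the column space, it preserves the dimension.
  Conversely, a kernel vector extended to a basis leaves one vector fewer to span the image.\<close>

lemma rank_mult_less_iff:
  fixes A :: "real^'n^'m" and Z :: "real^'k^'n"
  shows "rank (A ** Z) < rank Z \<longleftrightarrow> (\<exists>x\<in>range ((*v) Z). x \<noteq> 0 \<and> A *v x = 0)"
proof -
  let ?S = "range ((*v) Z)"
  have S: "subspace ?S" by (rule subspace_range_matrix)
  have rank_AZ: "rank (A ** Z) = dim ((*v) A ` ?S)"
    by (simp add: rank_dim_range image_image matrix_vector_mul_assoc)
  show ?thesis
  proof
    assume less: "rank (A ** Z) < rank Z"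
    show "\<exists>x\<in>?S. x \<noteq> 0 \<and> A *v x = 0"
    proof (rule ccontr)
      assume *: "\<not> ?thesis"
      have "inj_on ((*v) A) ?S"
      proof (rule inj_onI)
        fix x y assume xy: "x \<in> ?S" "y \<in> ?S" "A *v x = A *v y"
        then have "x - y \<in> ?S" "A *v (x - y) = 0"
          using S by (simp_all only: subspace_diff matrix_vector_mult_diff_distrib) simp
        then have "x - y = 0" using * by blast
        then show "x = y" by simp
      qed
      then have "inj_on ((*v) A) (span ?S)"
        using S by (simp only: span_eq_iff[THEN iffD2])
      then have "dim ((*v) A ` ?S) = dim ?S"
        by (intro dim_image_eq matrix_vector_mul_linear)
      then show False using less rank_AZ rank_dim_range[of Z] by simp
    qed
  next
    assume "\<exists>x\<in>?S. x \<noteq> 0 \<and> A *v x = 0"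
    then obtain x where x: "x \<in> ?S" "x \<noteq> 0" "A *v x = 0" by blast
    have "{x} \<subseteq> ?S" "independent {x}" using x by auto
    then obtain B where B: "{x} \<subseteq> B" "B \<subseteq> ?S" "independent B" "?S \<subseteq> span B"
      by (rule maximal_independent_subset_extend)
    have fin: "finite B" using B(3) independent_imp_finite by blast
    have "(*v) A ` ?S \<subseteq> span ((*v) A ` B)"
      using B(4) linear_span_image[OF matrix_vector_mul_linear, of A B] by blast
    moreover have "(*v) A ` B \<subseteq> insert 0 ((*v) A ` (B - {x}))" using x(3) by auto
    then have "span ((*v) A ` B) \<subseteq> span ((*v) A ` (B - {x}))"
      by (metis span_mono span_insert_0)
    ultimately have "dim ((*v) A ` ?S) \<le> card ((*v) A ` (B - {x}))"
      using fin by (intro dim_le_card) auto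
    also have "\<dots> \<le> card (B - {x})" using fin by (intro card_image_le) auto
    also have "\<dots> < card B" using fin B(1) by (intro card_Diff1_less) auto
    also have "card B = dim ?S" using B(2-4) dim_unique by metis
    finally show "rank (A ** Z) < rank Z" using rank_AZ rank_dim_range[of Z] by simp
  qed
qed

section \<open>Compactness of the projectors and of the encoded singularities\<close>

lemma continuous_on_matrix_mult [continuous_intros]:
  fixes f :: "'a::topological_space \<Rightarrow> real^'n^'m" and g :: "'a \<Rightarrow> real^'k^'n"
  assumes "continuous_on S f" "continuous_on S g"
  shows "continuous_on S (\<lambda>x. f x ** g x)"
  unfolding matrix_matrix_mult_def by (intro continuous_intros assms)

lemma continuous_on_trace [continuous_intros]:
  fixes f :: "'a::topological_space \<Rightarrow> real^'n^'n"
  assumes "continuous_on S f"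
  shows "continuous_on S (\<lambda>x. trace (f x))"
  unfolding trace_def by (intro continuous_intros assms)

text \<open>The defining equations are polynomial, hence closed, and the entries are bounded by
  1.\<close>

lemma compact_orthogonal_projectors: "compact {P :: real^'n^'n. orthogonal_projector P}"
proof -
  have "closed {P :: real^'n^'n. orthogonal_projector P}"
    unfolding orthogonal_projector_def transpose_def
    by (intro closed_Collect_conj closed_Collect_eq continuous_intros)
  moreover have "norm P \<le> (\<Sum>i\<in>(UNIV::'n set). \<Sum>j\<in>(UNIV::'n set). 1)"
    if "orthogonal_projector P" for P :: "real^'n^'n"
  proof -
    have "norm P \<le> (\<Sum>i\<in>UNIV. norm (P $ i))"
      unfolding norm_vec_def[of P] by (intro L2_set_le_sum) simp
    also have "\<dots> \<le> (\<Sum>i\<in>UNIV. \<Sum>j\<in>UNIV. \<bar>P $ i $ j\<bar>)"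
      by (intro sum_mono norm_le_l1_cart)
    also have "\<dots> \<le> (\<Sum>i\<in>(UNIV::'n set). \<Sum>j\<in>(UNIV::'n set). 1)"
      by (intro sum_mono orthogonal_projector_entry_le_1 that)
    finally show ?thesis .
  qed
  then have "bounded {P :: real^'n^'n. orthogonal_projector P}"
    unfolding bounded_iff by blast
  ultimately show ?thesis by (simp add: compact_eq_bounded_closed)
qed

text \<open>A singularity of \<open>A\<close> is encoded by the orthogonal projector \<open>P\<close> onto the column space
  together with a unit matrix \<open>W\<close>, annihilated by \<open>A\<close>, whose columns lie in that space. The rank
  is replaced by the trace, which is continuous.\<close>

definition projector_pairs :: "nat \<Rightarrow> ((real^'n^'n) \<times> (real^'k^'n)) set" where
  "projector_pairs r = {(P, W). orthogonal_projector P \<and> real r \<le> trace P \<and>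
     trace P \<le> real CARD('k) \<and> norm W = 1 \<and> P ** W = W}"

lemma compact_projector_pairs: "compact (projector_pairs r :: ((real^'n^'n) \<times> (real^'k^'n)) set)"
proof -
  have "projector_pairs r = ({P. orthogonal_projector P} \<times> sphere 0 1) \<inter>
      {p :: (real^'n^'n) \<times> (real^'k^'n). real r \<le> trace (fst p) \<and> trace (fst p) \<le> real CARD('k) \<and>
        fst p ** snd p = snd p}"
    by (auto simp: projector_pairs_def)
  moreover have "closed {p :: (real^'n^'n) \<times> (real^'k^'n). real r \<le> trace (fst p) \<and>
      trace (fst p) \<le> real CARD('k) \<and> fst p ** snd p = snd p}"
    by (intro closed_Collect_conj closed_Collect_le closed_Collect_eq continuous_intros)
  ultimately show ?thesis
    by (simp add: compact_Int_closed compact_Times compact_orthogonal_projectors)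
qed

lemma column_projector_in_projector_pairs:
  fixes Z W :: "real^'k^'n"
  assumes "r \<le> rank Z" "norm W = 1" "column_projector Z ** W = W"
  shows "(column_projector Z, W) \<in> projector_pairs r"
  using assms rank_bound[of Z]
  by (simp add: projector_pairs_def orthogonal_projector_column_projector trace_column_projector)

lemma projector_pair_of_singular:
  fixes Z :: "real^'k^'n"
  assumes "Z \<in> singularity_set r A"
  obtains W :: "real^'k^'n" where "(column_projector Z, W) \<in> projector_pairs r" "A ** W = 0"
proof -
  obtain x where x: "x \<in> range ((*v) Z)" "x \<noteq> 0" "A *v x = 0"
    using assms rank_mult_less_iff[of A Z] unfolding singularity_set_def by blast
  have Px: "column_projector Z *v x = x"
    using x(1) orthogonal_projector_fixes_range[OF orthogonal_projector_column_projector, of x Z]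
    by (simp add: range_column_projector)
  \<comment> \<open>All columns of \<open>V\<close> equal the kernel vector \<open>x\<close>;
    normalised, it is the second component of the pair.\<close>
  define V :: "real^'k^'n" where "V = (\<chi> i k. x $ i)"
  have mult_V: "B ** V = (\<chi> i k. (B *v x) $ i)" for B :: "real^'n^'l"
    by (simp add: V_def matrix_matrix_mult_def matrix_vector_mult_def vec_eq_iff)
  have "V \<noteq> 0" using x(2) by (auto simp: V_def vec_eq_iff)
  then have "norm (V /\<^sub>R norm V) = 1" by simp
  moreover have "column_projector Z ** V = V" by (simp add: mult_V Px) (simp add: V_def)
  then have "column_projector Z ** (V /\<^sub>R norm V) = V /\<^sub>R norm V"
    by (simp add: matrix_scalar_ac flip: scalar_matrix_assoc)
  moreover have "A ** V = 0" by (simp add: mult_V x(3) vec_eq_iff)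
  then have "A ** (V /\<^sub>R norm V) = 0"
    by (simp add: matrix_scalar_ac flip: scalar_matrix_assoc)
  moreover have "r \<le> rank Z" using assms by (simp add: singularity_set_def)
  ultimately show thesis
    using that column_projector_in_projector_pairs by blast
qed

text \<open>The trace bound makes \<open>P\<close> the projector of some matrix with
  \<open>CARD('k)\<close> columns. A nonzero vector in the range of \<open>W\<close> is a kernel
  vector of \<open>A\<close> in that column space.\<close>

lemma singular_of_projector_pair:
  fixes W :: "real^'k^'n"
  assumes PW: "(P, W) \<in> projector_pairs r" and AW: "A ** W = 0"
  obtains Z :: "real^'k^'n" where "Z \<in> singularity_set r A" "column_projector Z = P"
proof -
  have P: "orthogonal_projector P" and tr: "real r \<le> trace P" "trace P \<le> real CARD('k)"
    and W: "norm W = 1" "P ** W = W"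
    using PW unfolding projector_pairs_def by auto
  have "rank P \<le> CARD('k)" using tr(2) by (simp add: trace_orthogonal_projector[OF P])
  then obtain Z :: "real^'k^'n" where Z: "column_projector Z = P"
    using ex_column_projector_eq[OF P] by blast
  have "W \<noteq> 0" using W(1) by auto
  then obtain u where u: "W *v u \<noteq> 0" by (auto simp: matrix_eq)
  have "P *v (W *v u) = W *v u" using W(2) by (simp add: matrix_vector_mul_assoc)
  then have "W *v u \<in> range ((*v) Z)"
    using orthogonal_projector_fixes_range[OF P] range_column_projector[of Z] Z by metis
  moreover have "A *v (W *v u) = 0" using AW by (simp add: matrix_vector_mul_assoc)
  ultimately have "rank (A ** Z) < rank Z" using u rank_mult_less_iff by blast
  moreover have "r \<le> rank Z" using tr(1) Z trace_column_projector[of Z] by simp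
  ultimately show thesis using that Z by (simp add: singularity_set_def)
qed

section \<open>The spherical section property in terms of \<open>iota\<close>\<close>

text \<open>As a function of \<open>Z\<close>, \<open>owl21\<close> jumps where the rank drops; as a
  function of the projector it is continuous, and the pairs annihilated by \<open>A\<close> form a
  compact set.\<close>

lemma owl21_attains_inf_on_singularity_set:
  fixes A :: "real^'n^'m"
  assumes "(singularity_set r A :: (real^'k^'n) set) \<noteq> {}"
  obtains Z :: "real^'k^'n" where "Z \<in> singularity_set r A"
    "\<And>V :: real^'k^'n. V \<in> singularity_set r A \<Longrightarrow> owl21 Z \<le> owl21 V"
proof -
  define f where "f = (\<lambda>p :: (real^'n^'n) \<times> (real^'k^'n). \<Sum>i\<in>UNIV. sqrt (fst p $ i $ i))"
  define K where "K = (projector_pairs r :: ((real^'n^'n) \<times> (real^'k^'n)) set) \<inter> {p. A ** snd p = 0}"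
  have "closed {p :: (real^'n^'n) \<times> (real^'k^'n). A ** snd p = 0}"
    by (intro closed_Collect_eq continuous_intros)
  then have "compact K"
    unfolding K_def by (intro compact_Int_closed compact_projector_pairs)
  moreover have pair: "\<exists>W. (column_projector Z, W) \<in> K" if "Z \<in> singularity_set r A"
    for Z :: "real^'k^'n"
    using projector_pair_of_singular[OF that] unfolding K_def by auto
  then have "K \<noteq> {}" using assms by blast
  moreover have "continuous_on K f" unfolding f_def by (intro continuous_intros)
  ultimately obtain p where p: "p \<in> K" "\<And>q. q \<in> K \<Longrightarrow> f p \<le> f q"
    using continuous_attains_inf by metis
  obtain P W where PW: "p = (P, W)" by fastforce
  obtain Z :: "real^'k^'n" where Z: "Z \<in> singularity_set r A" "column_projector Z = P"
    using singular_of_projector_pair[of P W r A] p(1) unfolding PW K_def by auto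
  show thesis
  proof
    show "owl21 Z \<le> owl21 V" if V: "V \<in> singularity_set r A" for V :: "real^'k^'n"
    proof -
      obtain W' where "(column_projector V, W') \<in> K" using pair[OF V] by blast
      from p(2)[OF this] show ?thesis by (simp add: PW f_def owl21_eq Z(2))
    qed
  qed (rule Z(1))
qed

text \<open>Attainment of the infimum is what carries the strict inequality from the individual
  singularities over to \<open>iota\<close>.\<close>

lemma spherical_section_iff_iota:
  fixes A :: "real^'n^'m"
  assumes "r \<ge> 1"
  shows "spherical_section TYPE('k::finite) r s A \<longleftrightarrow>
    ereal (real s) < (iota TYPE('k) r A)\<^sup>2 / ereal (real r)"
proof (cases "(singularity_set r A :: (real^'k^'n) set) = {}")
  case True
  \<comment> \<open>Without singularities the infimum is infinite and both sides hold.\<close>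
  then have "iota TYPE('k) r A = \<infinity>" by (simp add: iota_def top_ereal_def)
  then show ?thesis using True by (simp add: spherical_section_def power2_eq_square)
next
  case False
  obtain Z :: "real^'k^'n" where Z: "Z \<in> singularity_set r A"
    "\<And>V :: real^'k^'n. V \<in> singularity_set r A \<Longrightarrow> owl21 Z \<le> owl21 V"
    using owl21_attains_inf_on_singularity_set[OF False] by metis
  have iota: "iota TYPE('k) r A = ereal (owl21 Z)"
    unfolding iota_def using Z by (intro antisym INF_lower INF_greatest) auto
  have "spherical_section TYPE('k) r s A \<longleftrightarrow> sqrt (real r * real s) < owl21 Z"
    unfolding spherical_section_def using Z by (blast intro: less_le_trans)
  also have "\<dots> \<longleftrightarrow> real r * real s < (owl21 Z)\<^sup>2"
    using real_sqrt_less_iff[of "real r * real s" "(owl21 Z)\<^sup>2"] by (simp add: owl21_nonneg)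
  also have "\<dots> \<longleftrightarrow> real s < (owl21 Z)\<^sup>2 / real r"
    using assms by (simp add: field_simps)
  finally show ?thesis using assms by (simp add: iota)
qed

section \<open>Spark and preservation of rank\<close>

text \<open>A kernel vector of \<open>A\<close> in the column space of \<open>X\<close> is supported
  on the nonzero rows of \<open>X\<close>. Its entries would be a dependence among too few columns
  of \<open>A\<close>.\<close>

lemma rank_mult_eq_of_rows_less_spark:
  fixes A :: "real^'n^'m" and X :: "real^'k^'n"
  assumes "enat (num_nonzero_rows X) < spark A"
  shows "rank (A ** X) = rank X"
proof (rule ccontr)
  assume "rank (A ** X) \<noteq> rank X"
  then have "rank (A ** X) < rank X" using rank_mul_le_right[of A X] by simp
  then obtain u where u: "X *v u \<noteq> 0" "A *v (X *v u) = 0"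
    using rank_mult_less_iff by blast
  define I where "I = {i. row i X \<noteq> 0}"
  have zero: "(X *v u) $ i = 0" if "i \<notin> I" for i
    using that by (simp add: I_def row_def matrix_vector_mult_def vec_eq_iff)
  obtain i where "(X *v u) $ i \<noteq> 0" using u(1) by (auto simp: vec_eq_iff)
  then have "\<exists>i\<in>I. (X *v u) $ i \<noteq> 0" using zero by blast
  moreover have "(\<Sum>i\<in>I. (X *v u) $ i *\<^sub>R column i A) = A *v (X *v u)"
    unfolding matrix_mult_sum[of A] scalar_mult_eq_scaleR
    by (rule sum.mono_neutral_left) (auto simp: zero)
  ultimately have "spark A \<le> enat (card I)"
    unfolding spark_def using u(2) by (intro Inf_lower) (auto intro!: exI[of _ I] exI[of _ "\<lambda>i. (X *v u) $ i"])
  then show False using assms by (simp add: num_nonzero_rows_def I_def)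
qed

section \<open>Bounded sublevel sets, existence of minimizers and minimizing sequences\<close>

text \<open>The slack \<open>e\<close> serves minimizing sequences, whose terms may exceed the
  optimal value and only come close to it eventually.\<close>

lemma bounded_sublevel_of_spherical_section:
  fixes A :: "real^'n^'m" and Y :: "real^'k^'m"
  assumes ssp: "spherical_section TYPE('k) r s A" and Y: "r \<le> rank Y"
  obtains e C where "e > 0"
    "\<And>Z. Z \<in> feasible A Y \<Longrightarrow> owl21 Z \<le> sqrt (real r * real s) + e \<Longrightarrow> norm Z \<le> C"
proof (rule ccontr)
  assume neg: "\<not> thesis"
  let ?L = "sqrt (real r * real s)"
  \<comment> \<open>The negated claim is applied with slack 1/(j+1) and bound j+1.\<close>
  have "\<exists>Z\<in>feasible A Y. owl21 Z \<le> ?L + inverse (real (Suc j)) \<and> real (Suc j) < norm Z" for j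
    using neg that[of "inverse (real (Suc j))" "real (Suc j)"] by (force simp: not_le)
  then obtain Z where Z: "\<And>j. Z j \<in> feasible A Y"
    "\<And>j. owl21 (Z j) \<le> ?L + inverse (real (Suc j))" "\<And>j. real (Suc j) < norm (Z j)"
    by metis
  define P where "P = (\<lambda>j. column_projector (Z j))"
  define W where "W = (\<lambda>j. Z j /\<^sub>R norm (Z j))"
  have AZ: "A ** Z j = Y" for j using Z(1) by (simp add: feasible_def)
  have pos: "norm (Z j) > 0" for j using Z(3)[of j] by linarith
  have "(P j, W j) \<in> projector_pairs r" for j
    unfolding P_def
  proof (rule column_projector_in_projector_pairs)
    \<comment> \<open>Feasibility forces rank at least that of \<open>Y\<close>, a bound that passes
      to the limit through the trace.\<close>
    show "r \<le> rank (Z j)" using Y rank_mul_le_right[of A "Z j"] AZ[of j] by simp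
    show "norm (W j) = 1" using pos[of j] by (simp add: W_def)
    show "column_projector (Z j) ** W j = W j"
      by (simp add: W_def matrix_scalar_ac column_projector_mult flip: scalar_matrix_assoc)
  qed
  then obtain l g where l: "l \<in> projector_pairs r" and g: "strict_mono (g :: nat \<Rightarrow> nat)"
    and lim: "((\<lambda>j. (P j, W j)) \<circ> g) \<longlonglongrightarrow> l"
    using seq_compactE[OF compact_imp_seq_compact[OF compact_projector_pairs],
        of "\<lambda>j. (P j, W j)" r] by blast
  obtain P0 W0 where l_eq: "l = (P0, W0)" by fastforce
  have limP: "(\<lambda>j. P (g j)) \<longlonglongrightarrow> P0" and limW: "(\<lambda>j. W (g j)) \<longlonglongrightarrow> W0"
    using tendsto_fst[OF lim] tendsto_snd[OF lim] by (simp_all add: l_eq o_def)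
  have "filterlim (\<lambda>j. norm (Z j)) at_top sequentially"
    by (rule filterlim_at_top_mono[OF filterlim_real_sequentially])
      (use Z(3) in \<open>force intro!: always_eventually intro: less_imp_le order.strict_trans[rotated]\<close>)
  then have "(\<lambda>j. inverse (norm (Z j)) *\<^sub>R Y) \<longlonglongrightarrow> 0 *\<^sub>R Y"
    by (intro tendsto_intros tendsto_inverse_0_at_top)
  \<comment> \<open>Normalising divides the fixed right-hand side by a norm that tends to infinity,
    so the limit direction lies in the kernel of \<open>A\<close>.\<close>
  moreover have "A ** W j = inverse (norm (Z j)) *\<^sub>R Y" for j
    by (simp add: W_def matrix_scalar_ac AZ flip: scalar_matrix_assoc)
  ultimately have "(\<lambda>j. A ** W j) \<longlonglongrightarrow> 0" by simp
  then have "(\<lambda>j. A ** W (g j)) \<longlonglongrightarrow> 0"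
    using LIMSEQ_subseq_LIMSEQ[OF _ g, of "\<lambda>j. A ** W j"] by (simp add: o_def)
  moreover have "continuous_on UNIV (\<lambda>W :: real^'k^'n. A ** W)" by (intro continuous_intros)
  then have "(\<lambda>j. A ** W (g j)) \<longlonglongrightarrow> A ** W0"
    using limW continuous_on_tendsto_compose by fastforce
  ultimately have AW0: "A ** W0 = 0" using LIMSEQ_unique by blast
  obtain Z0 :: "real^'k^'n" where Z0: "Z0 \<in> singularity_set r A" "column_projector Z0 = P0"
    using singular_of_projector_pair[OF l[unfolded l_eq] AW0] .
  \<comment> \<open>The values converge because they depend continuously on the projectors, whose
    limit is the projector of \<open>Z0\<close>.\<close>
  have "continuous_on UNIV (\<lambda>P :: real^'n^'n. \<Sum>i\<in>UNIV. sqrt (P $ i $ i))"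
    by (intro continuous_intros)
  then have "(\<lambda>j. \<Sum>i\<in>UNIV. sqrt (P (g j) $ i $ i)) \<longlonglongrightarrow> (\<Sum>i\<in>UNIV. sqrt (P0 $ i $ i))"
    using limP continuous_on_tendsto_compose by fastforce
  then have "(\<lambda>j. owl21 (Z (g j))) \<longlonglongrightarrow> owl21 Z0"
    by (simp add: owl21_eq P_def Z0(2))
  moreover have "(\<lambda>j. ?L + inverse (real (Suc (g j)))) \<longlonglongrightarrow> ?L + 0"
    using LIMSEQ_subseq_LIMSEQ[OF LIMSEQ_inverse_real_of_nat g]
    by (intro tendsto_intros) (simp add: o_def)
  ultimately have "owl21 Z0 \<le> ?L + 0"
    using Z(2) by (intro LIMSEQ_le) auto
  moreover have "?L < owl21 Z0" using ssp Z0(1) by (simp add: spherical_section_def)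
  ultimately show False by simp
qed

text \<open>Passing to a limit can shrink the column space, so the minimum is taken over pairs of a feasible
  matrix and a projector onto a subspace that may be larger than its column space.\<close>

lemma optimal_solutions_nonempty:
  fixes A :: "real^'n^'m" and Y :: "real^'k^'m"
  assumes X: "X \<in> feasible A Y"
    and bound: "\<And>Z. Z \<in> feasible A Y \<Longrightarrow> owl21 Z \<le> owl21 X \<Longrightarrow> norm Z \<le> C"
  shows "optimal_solutions A Y \<noteq> {}"
proof -
  define f where "f = (\<lambda>p :: (real^'n^'n) \<times> (real^'k^'n). \<Sum>i\<in>UNIV. sqrt (fst p $ i $ i))"
  define K where "K = ({P. orthogonal_projector P} \<times> cball 0 C) \<inter>
    {p :: (real^'n^'n) \<times> (real^'k^'n). fst p ** snd p = snd p \<and> A ** snd p = Y}"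
  have "closed {p :: (real^'n^'n) \<times> (real^'k^'n). fst p ** snd p = snd p \<and> A ** snd p = Y}"
    by (intro closed_Collect_conj closed_Collect_eq continuous_intros)
  then have "compact K"
    unfolding K_def by (intro compact_Int_closed compact_Times compact_orthogonal_projectors compact_cball)
  moreover have pair: "(column_projector Z, Z) \<in> K" if "Z \<in> feasible A Y" "owl21 Z \<le> owl21 X" for Z
    using that bound[OF that]
    by (simp add: K_def feasible_def orthogonal_projector_column_projector column_projector_mult)
  then have "K \<noteq> {}" using X by blast
  moreover have "continuous_on K f" unfolding f_def by (intro continuous_intros)
  ultimately obtain p where p: "p \<in> K" "\<And>q. q \<in> K \<Longrightarrow> f p \<le> f q"
    using continuous_attains_inf by metis
  obtain P Z where PZ: "p = (P, Z)" by fastforce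
  \<comment> \<open>The range of \<open>P\<close> may exceed the column space of \<open>Z\<close>;
    passing to the column space can only lower the value.\<close>
  have le: "owl21 Z \<le> f p"
    using p(1) owl21_le_sum_sqrt_diagonal[of P Z] by (simp add: PZ K_def f_def)
  have low: "owl21 Z \<le> owl21 V" if "V \<in> feasible A Y" "owl21 V \<le> owl21 X" for V
    using le p(2)[OF pair[OF that]] by (simp add: f_def owl21_eq)
  \<comment> \<open>Matrices with a value above that of \<open>X\<close> lie outside
    \<open>K\<close> possibly, and are handled by comparison with \<open>X\<close>.\<close>
  have "owl21 Z \<le> owl21 V" if "V \<in> feasible A Y" for V
    using low[OF that] low[OF X] by linarith
  moreover have "Z \<in> feasible A Y" using p(1) by (simp add: PZ K_def feasible_def)
  ultimately show ?thesis unfolding optimal_solutions_def by blast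
qed

text \<open>The optimal value is at most \<open>owl21 X\<close>, hence below \<open>c\<close>, so a
  tail of the sequence lies in the bounded sublevel set.\<close>

lemma bounded_minimizing_sequence:
  assumes Z: "minimizing_sequence A Y Z" and X: "X \<in> feasible A Y" and "owl21 X < c"
    and bound: "\<And>V. V \<in> feasible A Y \<Longrightarrow> owl21 V \<le> c \<Longrightarrow> norm V \<le> C"
  shows "bounded (range Z)"
proof -
  have "optimal_value A Y \<le> ereal (owl21 X)"
    unfolding optimal_value_def using X by (rule INF_lower)
  also have "\<dots> < ereal c" using assms(3) by simp
  finally have "eventually (\<lambda>j. ereal (owl21 (Z j)) < ereal c) sequentially"
    using Z order_tendstoD(2) unfolding minimizing_sequence_def by blast
  then have "eventually (\<lambda>j. norm (Z j) \<le> C) sequentially"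
    by eventually_elim (use Z bound in \<open>simp add: minimizing_sequence_def\<close>)
  then have "Bseq Z" by (rule BfunI)
  then show ?thesis by (simp add: Bseq_eq_bounded)
qed

theorem proposition4p5:
  fixes A :: "real^'n^'m" and X :: "real^'k^'n" and Y :: "real^'k^'m" and r s :: nat
  assumes "rank X = r" and "r \<ge> 1"
    and "num_nonzero_rows X = s"
    and "Y = A ** X"
  shows "((enat s < spark A \<and> spherical_section TYPE('k) r s A) \<longleftrightarrow>
            (r \<le> s \<and> ereal (real s) <
               min ((iota TYPE('k) r A)\<^sup>2 / ereal (real r)) (ereal_of_enat (spark A)))) \<and>
         (enat s < spark A \<and> spherical_section TYPE('k) r s A \<longrightarrow>
            (\<forall>Z. minimizing_sequence A Y Z \<longrightarrow> bounded (range Z)) \<and>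
            optimal_solutions A Y \<noteq> {})"
proof (intro conjI impI)
  \<comment> \<open>The row count of \<open>X\<close> gives this inequality; the minimum then splits
    into the spark condition and the \<open>iota\<close> condition.\<close>
  have "r \<le> s" using rank_le_num_nonzero_rows[of X] assms by simp
  moreover have "ereal (real s) < ereal_of_enat (spark A) \<longleftrightarrow> enat s < spark A"
    using ereal_of_enat_less_iff[of "enat s" "spark A"] by simp
  ultimately show "(enat s < spark A \<and> spherical_section TYPE('k) r s A) \<longleftrightarrow>
      (r \<le> s \<and> ereal (real s) <
        min ((iota TYPE('k) r A)\<^sup>2 / ereal (real r)) (ereal_of_enat (spark A)))"
    using spherical_section_iff_iota[OF assms(2), where 'k='k and A=A and s=s] by auto
next
  assume *: "enat s < spark A \<and> spherical_section TYPE('k) r s A"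
  \<comment> \<open>The spark condition lets \<open>A\<close> preserve the rank of \<open>X\<close>,
    which gives the rank bound on \<open>Y\<close> for the sublevel estimate.\<close>
  then have "rank Y = r" using rank_mult_eq_of_rows_less_spark[of X A] assms by simp
  then obtain e C where e: "e > 0"
    and bound: "\<And>Z. Z \<in> feasible A Y \<Longrightarrow> owl21 Z \<le> sqrt (real r * real s) + e \<Longrightarrow> norm Z \<le> C"
    using * bounded_sublevel_of_spherical_section[of r s A Y] by auto
  have X: "X \<in> feasible A Y" using assms(4) by (simp add: feasible_def)
  have owl_X: "owl21 X \<le> sqrt (real r * real s)"
    using owl21_le_sqrt_rank_rows[of X] assms by simp
  show "optimal_solutions A Y \<noteq> {}"
    using X by (rule optimal_solutions_nonempty) (use bound owl_X e in force)
  \<comment> \<open>The threshold is \<open>sqrt (real r * real s) + e\<close>, which is strictly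
    above \<open>owl21 X\<close>.\<close>
  show "\<forall>Z. minimizing_sequence A Y Z \<longrightarrow> bounded (range Z)"
    using bounded_minimizing_sequence[OF _ X _ bound] owl_X e by force
qed

end
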